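(* Let $a<b$ be real numbers, $\sigma>0$ and $x_0=\frac{a+b}{2}$. For $\mu\in\mathbb{R}$ let $L^{\sigma,\mu}=\frac{\sigma^2}{2}\frac{d^2}{dx^2}+\mu\frac{d}{dx}$, let $(X_t)_{t\ge0}$ be the $L^{\sigma,\mu}$-diffusion in $(a,b)$ with jump boundary and deterministic jump distribution $\delta_{x_0}$, let $\gamma_1(L^{\sigma,\mu},\delta_{x_0})$ denote its spectral gap, and let $(\mathcal{L},\mathcal{D}(\mathcal{L}))$ be its generator, i.e. $\mathcal{L}f=\frac{\sigma^2}{2}f''+\mu f'$ on $\mathcal{D}(\mathcal{L})=\{f\in C^2([a,b]): f(a)=f(b)=f(x_0)\}$. Then there exists $\mu_0$ such that for all $\mu\ge\mu_0$ $$\bigl\{\tilde\lambda : \Re\tilde\lambda=\gamma_1(L^{\sigma,\mu},\delta_{x_0}),\ \tilde\lambda\text{ is an eigenvalue of }(-\mathcal{L},\mathcal{D}(\mathcal{L}))\bigr\}\subset\mathbb{C}\setminus\mathbb{R}.$$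
   Context: Diffusion with jump boundary: let $\nu$ be a probability measure on $(a,b)$. The $L^{\sigma,\mu}$-diffusion in $(a,b)$ with jump boundary and jump distribution $\nu$, started at $x\in(a,b)$, is the process $(X_t)_{t\ge0}$ which moves as $x+\sigma B_t+\mu t$ ($B$ a standard one-dimensional Brownian motion) until it first hits $\{a,b\}$; at that time it is instantly relocated to a point chosen according to $\nu$ (independently of the past), then again moves as a Brownian motion with diffusion coefficient $\sigma$ and drift $\mu$ until it next hits $\{a,b\}$, is relocated according to $\nu$, and so on forever. For $\nu=\delta_{x_0}$ it is always relocated to $x_0$. $\mathbb{P}_x$ denotes the law of the process started at $x$. The process has a unique invariant probability distribution $\pi$, and its spectral gap is $$\gamma_1(L^{\sigma,\mu},\nu)=-\lim_{t\to\infty}\frac1t\log\sup_{x\in(a,b)}\bigl\|\mathbb{P}_x(X_t\in\cdot)-\pi\bigr\|_{TV}>0,$$ where $\|\cdot\|_{TV}$ is the total variation distance $\|P-Q\|_{TV}=\sup_A|P(A)-Q(A)|$. It is known that $\gamma_1(L^{\sigma,\mu},\nu)=\min\{\Re\tilde\lambda : \tilde\lambda\neq0,\ -\tilde\lambda \text{ is an eigenvalue of }(\mathcal{L},\mathcal{D}(\mathcal{L}))\}$, where in general $\mathcal{D}(\mathcal{L})=\{f\in C^2([a,b]): f(a)=f(b)=\int_{(a,b)} f\,d\nu\}$ ($f$ complex valued) and $\mathcal{L}f=\frac{\sigma^2}{2}f''+\mu f'$. *)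

theory Defs
  imports "HOL-Probability.Probability"
begin

definition standard_brownian_motion :: "'w measure \<Rightarrow> (real \<Rightarrow> 'w \<Rightarrow> real) \<Rightarrow> bool" where
  "standard_brownian_motion M B \<longleftrightarrow>
     prob_space M \<and>
     (\<forall>t\<ge>0. B t \<in> borel_measurable M) \<and>
     (AE \<omega> in M. B 0 \<omega> = 0) \<and>
     (AE \<omega> in M. continuous_on {0..} (\<lambda>t. B t \<omega>)) \<and>
     (\<forall>s t. 0 \<le> s \<longrightarrow> s < t \<longrightarrow>
        distributed M lborel (\<lambda>\<omega>. B t \<omega> - B s \<omega>) (normal_density 0 (sqrt (t - s)))) \<and>
     (\<forall>(\<tau> :: nat \<Rightarrow> real) n. 0 \<le> \<tau> 0 \<longrightarrow> mono \<tau> \<longrightarrow>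
        prob_space.indep_vars M (\<lambda>_. borel)
          (\<lambda>i \<omega>. B (\<tau> (Suc i)) \<omega> - B (\<tau> i) \<omega>) {..<n})"

definition interval_space :: "real \<Rightarrow> real \<Rightarrow> real measure" where
  "interval_space a b = restrict_space borel {a<..<b}"

text \<open>
  \<open>X\<close> is the path driven by \<open>w\<close> which starts at \<open>y 0\<close> and is relocated to \<open>y n\<close> at its
  \<open>n\<close>-th visit to the boundary. \<open>T n\<close> is the time of that visit (with \<open>T 0 = 0\<close>): on
  \<open>[T n, T (n + 1))\<close> the path stays inside the interval, and its left limit at \<open>T (n + 1)\<close>
  is an endpoint. For Brownian \<open>w\<close> and independent relocation points distributed according to a
  fixed law on \<open>(a, b)\<close>, such times exist and tend to infinity almost surely.
\<close>

definition jump_boundary_path ::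
  "real \<Rightarrow> real \<Rightarrow> real \<Rightarrow> real \<Rightarrow> (real \<Rightarrow> real) \<Rightarrow> (nat \<Rightarrow> real) \<Rightarrow> (real \<Rightarrow> real) \<Rightarrow> bool" where
  "jump_boundary_path a b \<sigma> \<mu> w y X \<longleftrightarrow>
     (\<exists>T :: nat \<Rightarrow> real. T 0 = 0 \<and> strict_mono T \<and> filterlim T at_top sequentially \<and>
        (\<forall>n. (\<forall>t\<in>{T n..<T (Suc n)}.
                X t = y n + \<sigma> * (w t - w (T n)) + \<mu> * (t - T n) \<and> X t \<in> {a<..<b}) \<and>
             y n + \<sigma> * (w (T (Suc n)) - w (T n)) + \<mu> * (T (Suc n) - T n) \<in> {a, b}))"

text \<open>
  One Brownian motion \<open>B\<close> drives all the excursions: by the strong Markov property its increments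
  after a relocation time form a Brownian motion independent of the past. The relocation points
  \<open>Y 0, Y 1, \<dots>\<close> are independent with law \<open>\<nu>\<close> and independent of \<open>B\<close>.
\<close>

definition jump_boundary_diffusion ::
  "'w measure \<Rightarrow> real \<Rightarrow> real \<Rightarrow> real \<Rightarrow> real \<Rightarrow> real measure \<Rightarrow> real \<Rightarrow> (real \<Rightarrow> 'w \<Rightarrow> real) \<Rightarrow> bool" where
  "jump_boundary_diffusion M a b \<sigma> \<mu> \<nu> x X \<longleftrightarrow>
     (\<exists>B Y. standard_brownian_motion M B \<and>
        (\<forall>n. Y n \<in> measurable M (interval_space a b) \<and> distr M (interval_space a b) (Y n) = \<nu>) \<and>
        prob_space.indep_vars M (\<lambda>_. interval_space a b) Y (UNIV :: nat set) \<and>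
        prob_space.indep_set M
          (sets (vimage_algebra (space M) (\<lambda>\<omega>. \<lambda>t\<in>{0..}. B t \<omega>) (\<Pi>\<^sub>M t\<in>{0..}. borel)))
          (sets (vimage_algebra (space M) (\<lambda>\<omega> n. Y n \<omega>) (\<Pi>\<^sub>M n\<in>UNIV. interval_space a b))) \<and>
        (\<forall>t\<ge>0. X t \<in> measurable M (interval_space a b)) \<and>
        (AE \<omega> in M. jump_boundary_path a b \<sigma> \<mu> (\<lambda>t. B t \<omega>)
           (case_nat x (\<lambda>n. Y n \<omega>)) (\<lambda>t. X t \<omega>)))"

definition tv_dist :: "'a measure \<Rightarrow> 'a measure \<Rightarrow> real" where
  "tv_dist P Q = (SUP A\<in>sets P. \<bar>measure P A - measure Q A\<bar>)"

text \<open>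
  In the following two definitions \<open>K t x\<close> is the law at time \<open>t\<close> of the process started at \<open>x\<close>.
  Measurability of \<open>K t\<close> is what makes the mixture \<open>\<pi> \<bind> K t\<close> meaningful.
  A spectral gap is by convention strictly positive. For the processes considered here this is a
  known property of the limit, as are the existence of the limit and the existence and uniqueness
  of \<open>\<pi>\<close>.
\<close>

definition invariant_distribution ::
  "'a measure \<Rightarrow> (real \<Rightarrow> 'a \<Rightarrow> 'a measure) \<Rightarrow> 'a measure \<Rightarrow> bool" where
  "invariant_distribution S K \<pi> \<longleftrightarrow>
     prob_space \<pi> \<and> sets \<pi> = sets S \<and>
     (\<forall>t\<ge>0. K t \<in> measurable S (prob_algebra S) \<and> \<pi> \<bind> K t = \<pi>)"

definition has_spectral_gap ::
  "'a measure \<Rightarrow> (real \<Rightarrow> 'a \<Rightarrow> 'a measure) \<Rightarrow> real \<Rightarrow> bool" where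
  "has_spectral_gap S K \<gamma> \<longleftrightarrow>
     0 < \<gamma> \<and>
     (\<exists>\<pi>. invariant_distribution S K \<pi> \<and>
        ((\<lambda>t. - (1 / t * ln (SUP x\<in>space S. tv_dist (K t x) \<pi>))) \<longlongrightarrow> \<gamma>) at_top)"

definition interval_deriv :: "real \<Rightarrow> real \<Rightarrow> (real \<Rightarrow> complex) \<Rightarrow> real \<Rightarrow> complex" where
  "interval_deriv a b f x = vector_derivative f (at x within {a..b})"

definition C2_interval :: "real \<Rightarrow> real \<Rightarrow> (real \<Rightarrow> complex) set" where
  "C2_interval a b =
     {f. f differentiable_on {a..b} \<and>
         interval_deriv a b f differentiable_on {a..b} \<and>
         continuous_on {a..b} (interval_deriv a b (interval_deriv a b f))}"

definition generator ::
  "real \<Rightarrow> real \<Rightarrow> real \<Rightarrow> real \<Rightarrow> (real \<Rightarrow> complex) \<Rightarrow> real \<Rightarrow> complex" where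
  "generator a b \<sigma> \<mu> f x =
     of_real (\<sigma>\<^sup>2 / 2) * interval_deriv a b (interval_deriv a b f) x
       + of_real \<mu> * interval_deriv a b f x"

definition generator_domain :: "real \<Rightarrow> real \<Rightarrow> real \<Rightarrow> (real \<Rightarrow> complex) set" where
  "generator_domain a b x\<^sub>0 = {f \<in> C2_interval a b. f a = f b \<and> f b = f x\<^sub>0}"

text \<open>Functions on \<open>S\<close> are represented by total functions whose values off \<open>S\<close> are irrelevant.\<close>

definition is_eigenvalue ::
  "'a set \<Rightarrow> (('a \<Rightarrow> complex) \<Rightarrow> 'a \<Rightarrow> complex) \<Rightarrow> ('a \<Rightarrow> complex) set \<Rightarrow> complex \<Rightarrow> bool" where
  "is_eigenvalue S A D z \<longleftrightarrow>
     (\<exists>f\<in>D. (\<exists>x\<in>S. f x \<noteq> 0) \<and> (\<forall>x\<in>S. A f x = z * f x))"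

end

theory Submission imports Defs begin

text \<open>
  Both sides of the claim are controlled by explicit exponentials. Write \<open>h = (b - a) / 2\<close> for
  the distance from the midpoint \<open>x\<^sub>0\<close> to either endpoint and \<open>\<omega> = 2 \<pi> / h\<close>.

  The spectral gap stays bounded as the drift grows. A relocation from an endpoint to the midpoint
  shifts the path by \<open>\<plusminus>h\<close>, so an \<open>h\<close>-periodic function of the process cannot tell \<open>X t\<close> from the
  free motion \<open>x + \<sigma> B t + \<mu> t\<close> (\<open>periodic_observable_of_jump_boundary_path\<close>). The characteristic
  function of the normal law therefore gives the expectation of \<open>cos (\<omega> X t + \<theta>)\<close> in closed form:
  its amplitude is \<open>exp (- \<kappa> t)\<close> with \<open>\<kappa> = (\<omega> \<sigma>)\<^sup>2 / 2\<close>, and the drift only turns the phase. In the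
  invariant distribution these functions have mean zero, so the total variation distance to it is
  at least of order \<open>exp (- \<kappa> t)\<close>, and the gap is at most \<open>\<kappa>\<close>, whatever the positive drift
  (\<open>spectral_gap_jump_boundary_le\<close>).

  The positive real eigenvalues run off to infinity. For \<open>0 < \<gamma> < \<mu>\<^sup>2 / (2 \<sigma>\<^sup>2)\<close> the equation
  \<open>- L f = \<gamma> f\<close> has two distinct negative real exponents, and a combination of two such exponentials
  that takes the same value at three equally spaced points vanishes
  (\<open>small_positive_real_not_eigenvalue\<close>). Once \<open>\<mu>\<close> exceeds \<open>\<omega> \<sigma>\<^sup>2\<close>, the interval of excluded real
  numbers contains \<open>\<kappa>\<close> and hence the gap, which is positive by definition. An eigenvalue whose real
  part is the gap can then not be real.
\<close>

section \<open>Total variation and bounded integrands\<close>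

lemma abs_measure_diff_le_tv_dist:
  assumes "prob_space P" "prob_space Q" "A \<in> sets P"
  shows "\<bar>measure P A - measure Q A\<bar> \<le> tv_dist P Q"
proof -
  have "\<bar>measure P C - measure Q C\<bar> \<le> 1" for C
    using prob_space.prob_le_1[OF assms(1), of C] prob_space.prob_le_1[OF assms(2), of C]
      measure_nonneg[of P C] measure_nonneg[of Q C] by linarith
  then have "bdd_above ((\<lambda>C. \<bar>measure P C - measure Q C\<bar>) ` sets P)"
    by (auto simp: bdd_above_def)
  from cSUP_upper[OF assms(3) this] show ?thesis
    unfolding tv_dist_def .
qed

lemma tv_dist_le_1:
  assumes "prob_space P" "prob_space Q"
  shows "tv_dist P Q \<le> 1"
  unfolding tv_dist_def
proof (rule cSUP_least)
  show "\<bar>measure P A - measure Q A\<bar> \<le> 1" for A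
    using prob_space.prob_le_1[OF assms(1), of A] prob_space.prob_le_1[OF assms(2), of A]
      measure_nonneg[of P A] measure_nonneg[of Q A] by linarith
qed (use sets.empty_sets in blast)

text \<open>
  The distance \<open>tv_dist\<close> compares probabilities of single events. A function with values in
  \<open>[0, 1]\<close> is within \<open>1 / n\<close> of the average of the indicators of its \<open>n\<close> superlevel sets at the
  heights \<open>k / n\<close>, which carries the comparison over to its integrals.
\<close>

lemma staircase_approximation:
  fixes v :: real
  assumes "0 \<le> v" "v \<le> 1" "0 < n"
  shows "\<bar>v - (\<Sum>k=1..n. if real k / n \<le> v then 1 else 0) / n\<bar> \<le> 1 / n"
proof -
  \<comment> \<open>The staircase at \<open>v\<close> counts the heights below \<open>v\<close>, so it has the value \<open>m / n\<close>.\<close>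
  define m where "m = nat \<lfloor>n * v\<rfloor>"
  have m: "real m \<le> n * v" "n * v < real m + 1"
    unfolding m_def using assms by (auto simp: of_nat_nat)
  have "real m \<le> n"
    using m(1) assms mult_left_mono[of v 1 "real n"] by linarith
  then have "m \<le> n" by simp
  have step: "real k / n \<le> v \<longleftrightarrow> k \<le> m" for k :: nat
  proof -
    have "real k / n \<le> v \<longleftrightarrow> real k \<le> n * v"
      using assms(3) by (simp add: divide_le_eq mult.commute)
    also have "\<dots> \<longleftrightarrow> k \<le> m"
      using m by linarith
    finally show ?thesis .
  qed
  have "{1..n} \<inter> {k. k \<le> m} = {1..m}"
    using \<open>m \<le> n\<close> by auto
  then have "(\<Sum>k=1..n. if real k / n \<le> v then 1 else 0) = real m"
    unfolding step by (simp add: sum.If_cases)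
  moreover have "v - real m / n = (n * v - real m) / n"
    using assms(3) by (simp add: diff_divide_distrib)
  moreover have "\<bar>n * v - real m\<bar> / n \<le> 1 / n"
    using m by (intro divide_right_mono) auto
  ultimately show ?thesis
    by simp
qed

text \<open>
  Replacing \<open>u\<close> by the average of the indicators of its superlevel sets costs \<open>1 / n\<close> in either
  integral, and the average of the differences of their measures is at most the total variation
  distance; then \<open>n\<close> tends to infinity.
\<close>

lemma abs_integral_diff_le_tv_dist:
  fixes u :: "'a \<Rightarrow> real"
  assumes P: "prob_space P" and Q: "prob_space Q" and sets: "sets P = sets Q"
    and u[measurable]: "u \<in> borel_measurable P" and bounds: "\<And>x. 0 \<le> u x \<and> u x \<le> 1"
  shows "\<bar>(\<integral>x. u x \<partial>P) - (\<integral>x. u x \<partial>Q)\<bar> \<le> tv_dist P Q"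
proof -
  interpret P: prob_space P by fact
  interpret Q: prob_space Q by fact
  have [measurable]: "u \<in> borel_measurable Q"
    using u measurable_cong_sets[OF sets refl] by blast
  have "\<bar>(\<integral>x. u x \<partial>P) - (\<integral>x. u x \<partial>Q)\<bar> \<le> tv_dist P Q + 2 / n" if "0 < n" for n :: nat
  proof -
    define A where "A k = {x \<in> space P. real k / n \<le> u x}" for k
    define s where "s x = (\<Sum>k=1..n. indicator (A k) x) / real n" for x
    have A[measurable]: "A k \<in> sets P" for k
      unfolding A_def by measurable
    have AQ[measurable]: "A k \<in> sets Q" for k
      using A sets by blast
    have s: "\<bar>u x - s x\<bar> \<le> 1 / n" if "x \<in> space P" for x
    proof -
      have "indicator (A k) x = (if real k / n \<le> u x then 1 else (0::real))" for k
        using that by (simp add: A_def)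
      then have "s x = (\<Sum>k=1..n. if real k / n \<le> u x then 1 else 0) / n"
        by (simp only: s_def)
      then show ?thesis
        using staircase_approximation[of "u x" n] bounds[of x] \<open>0 < n\<close> by simp
    qed
    have error: "\<bar>(\<integral>x. u x \<partial>R) - (\<Sum>k=1..n. measure R (A k)) / n\<bar> \<le> 1 / n"
      if R: "prob_space R" and [simp]: "space R = space P"
        and [measurable]: "u \<in> borel_measurable R" "\<And>k. A k \<in> sets R" for R
    proof -
      interpret R: prob_space R by fact
      have intu: "integrable R u"
        using bounds by (intro R.integrable_const_bound[of _ 1]) auto
      have "integrable R (indicat_real (A k))" for k
        by (intro integrable_real_indicator that) (simp add: R.emeasure_eq_measure)
      then have ints: "integrable R s"
        unfolding s_def by (intro integrable_divide_zero Bochner_Integration.integrable_sum)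
      have "(\<integral>x. s x \<partial>R) = (\<Sum>k=1..n. measure R (A k)) / n"
        unfolding s_def using \<open>\<And>k. integrable R (indicat_real (A k))\<close>
        by (simp add: Bochner_Integration.integral_sum)
      then have "\<bar>(\<integral>x. u x \<partial>R) - (\<Sum>k=1..n. measure R (A k)) / n\<bar> = \<bar>\<integral>x. u x - s x \<partial>R\<bar>"
        using intu ints by simp
      also have "\<dots> \<le> (\<integral>x. \<bar>u x - s x\<bar> \<partial>R)"
        by (rule integral_abs_bound)
      also have "\<dots> \<le> (\<integral>x. 1 / n \<partial>R)"
        using intu ints s by (intro integral_mono) auto
      finally show ?thesis
        using R.prob_space by simp
    qed
    have "\<bar>(\<Sum>k=1..n. measure P (A k)) / n - (\<Sum>k=1..n. measure Q (A k)) / n\<bar>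
        = \<bar>\<Sum>k=1..n. measure P (A k) - measure Q (A k)\<bar> / n"
      by (simp add: sum_subtractf diff_divide_distrib[symmetric])
    also have "\<dots> \<le> (\<Sum>k=1..n. \<bar>measure P (A k) - measure Q (A k)\<bar>) / n"
      by (intro divide_right_mono sum_abs) auto
    also have "\<dots> \<le> (\<Sum>k=1..n. tv_dist P Q) / n"
      by (intro divide_right_mono sum_mono abs_measure_diff_le_tv_dist P Q A) auto
    also have "\<dots> = tv_dist P Q"
      using \<open>0 < n\<close> by simp
    finally show ?thesis
      using error[OF P refl u A] error[OF Q _ _ AQ] sets_eq_imp_space_eq[OF sets] by simp
  qed
  note bound = this
  have "(\<lambda>n. tv_dist P Q + 2 / real n) \<longlonglongrightarrow> tv_dist P Q + 0"
    by (intro tendsto_intros tendsto_divide_0[OF tendsto_const]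
        filterlim_at_top_imp_at_infinity filterlim_real_sequentially)
  moreover have "\<forall>\<^sub>F n in sequentially. \<bar>(\<integral>x. u x \<partial>P) - (\<integral>x. u x \<partial>Q)\<bar> \<le> tv_dist P Q + 2 / real n"
    using eventually_gt_at_top[of 0] by eventually_elim (rule bound)
  ultimately show ?thesis
    using tendsto_lowerbound[of "\<lambda>n. tv_dist P Q + 2 / real n" "tv_dist P Q + 0" sequentially] by simp
qed

section \<open>Periodic observables do not see the relocations\<close>

text \<open>
  Continuing the \<open>n\<close>-th excursion beyond its exit time instead of relocating gives a free path
  that differs from the next excursion by half the length of the interval, in one direction or the
  other. That is a period of \<open>g\<close>, so \<open>g\<close> takes the same values along the continuations of all
  excursions, in particular along that of the first one.
\<close>

lemma periodic_observable_of_jump_boundary_path: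
  fixes g :: "real \<Rightarrow> 'a"
  assumes path: "jump_boundary_path a b \<sigma> \<mu> w y X"
    and relocation: "\<And>n. y (Suc n) = (a + b) / 2"
    and periodic: "\<And>r. g (r + (b - a) / 2) = g r"
    and "0 \<le> t"
  shows "g (X t) = g (y 0 + \<sigma> * (w t - w 0) + \<mu> * t)"
proof -
  from path obtain T where T0: "T 0 = (0::real)" and mono: "strict_mono T"
    and lim: "filterlim T at_top sequentially"
    and inside: "\<And>n t. t \<in> {T n..<T (Suc n)} \<Longrightarrow> X t = y n + \<sigma> * (w t - w (T n)) + \<mu> * (t - T n)"
    and hit: "\<And>n. y n + \<sigma> * (w (T (Suc n)) - w (T n)) + \<mu> * (T (Suc n) - T n) \<in> {a, b}"
    unfolding jump_boundary_path_def by blast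
  \<comment> \<open>The continuation of the \<open>n\<close>-th excursion, extended to all times.\<close>
  define free where "free n s = y n + \<sigma> * (w s - w (T n)) + \<mu> * (s - T n)" for n s
  have restart: "g (free (Suc n) s) = g (free n s)" for n s
  proof -
    define h where "h = (b - a) / 2"
    have "free n s = free (Suc n) s + h \<or> free (Suc n) s = free n s + h"
      using hit[of n] relocation[of n] unfolding free_def h_def by (auto simp: field_simps)
    then show ?thesis
      using periodic unfolding h_def by metis
  qed
  have free: "g (free n s) = g (free 0 s)" for n s
    by (induction n) (simp_all add: restart)
  obtain n where n: "T n \<le> t" "t < T (Suc n)"
  proof -
    obtain N where N: "t < T N"
      using lim by (metis filterlim_at_top_dense eventually_sequentially le_refl)
    define k where "k = (LEAST k. t < T k)"
    have "t < T k"
      unfolding k_def by (rule LeastI) (rule N)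
    moreover then obtain m where m: "k = Suc m"
      using T0 \<open>0 \<le> t\<close> by (cases k) auto
    moreover have "\<not> t < T m"
      using not_less_Least[of m "\<lambda>k. t < T k"] m unfolding k_def by simp
    ultimately show ?thesis
      using that[of m] by simp
  qed
  then have "X t = free n t"
    using inside[of t n] by (simp add: free_def)
  then show ?thesis
    using free[of n t] T0 by (simp add: free_def)
qed

lemma (in prob_space) expectation_cos_normal:
  assumes Z: "distributed M lborel Z (normal_density 0 s)" and "0 < s"
  shows "expectation (\<lambda>\<omega>. cos (\<theta> + u * Z \<omega>)) = exp (- (u * s)\<^sup>2 / 2) * cos \<theta>"
proof -
  interpret N: real_distribution std_normal_distribution
    by (rule real_dist_normal_dist)
  have D: "distributed M lborel (\<lambda>\<omega>. Z \<omega> / s) std_normal_density"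
    using Z normal_standard_normal_convert[OF \<open>0 < s\<close>, of Z 0] by simp
  have "expectation (\<lambda>\<omega>. cos (\<theta> + u * Z \<omega>))
      = expectation (\<lambda>\<omega>. cos (\<theta> + u * s * (Z \<omega> / s)))"
    using \<open>0 < s\<close> by simp
  also have "\<dots> = (\<integral>x. std_normal_density x * cos (\<theta> + u * s * x) \<partial>lborel)"
    by (rule distributed_integral[OF D, symmetric]) auto
  also have "\<dots> = (\<integral>x. cos (\<theta> + u * s * x) \<partial>std_normal_distribution)"
    by (subst integral_real_density) auto
  also have "\<dots> = (\<integral>x. Re (cis \<theta> * iexp (u * s * x)) \<partial>std_normal_distribution)"
    by (simp add: cis_conv_exp[symmetric] cis_mult del: of_real_mult)
  also have "\<dots> = Re (\<integral>x. cis \<theta> * iexp (u * s * x) \<partial>std_normal_distribution)"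
    by (rule integral_Re) (intro integrable_mult_right N.integrable_iexp, auto)
  also have "\<dots> = Re (cis \<theta> * char std_normal_distribution (u * s))"
    by (simp add: char_def)
  finally show ?thesis
    by (simp add: char_std_normal_distribution Re_divide_numeral mult.commute)
qed

text \<open>
  With \<open>\<omega> = 4 \<pi> / (b - a)\<close> half the length of the interval is a full period of the cosine, so
  \<open>X t\<close> may be replaced by \<open>x + \<sigma> B t + \<mu> t\<close>.
\<close>

lemma expectation_cos_jump_boundary_diffusion:
  assumes "a < b" "0 < \<sigma>" and x: "x \<in> {a<..<b}" and "0 < t"
    and X: "jump_boundary_diffusion M a b \<sigma> \<mu> (return (interval_space a b) ((a + b) / 2)) x X"
  defines "\<omega> \<equiv> 4 * pi / (b - a)"
  shows "(\<integral>y. cos (\<omega> * y + \<theta>) \<partial>distr M (interval_space a b) (X t))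
    = exp (- ((\<omega> * \<sigma>)\<^sup>2 / 2) * t) * cos (\<omega> * x + \<omega> * \<mu> * t + \<theta>)"
proof -
  let ?S = "interval_space a b"
  let ?m = "(a + b) / 2"
  from X obtain B Y where BM: "standard_brownian_motion M B"
    and Y: "\<And>n. Y n \<in> measurable M ?S" "\<And>n. distr M ?S (Y n) = return ?S ?m"
    and Xm: "\<And>t. 0 \<le> t \<Longrightarrow> X t \<in> measurable M ?S"
    and path: "AE \<xi> in M. jump_boundary_path a b \<sigma> \<mu> (\<lambda>t. B t \<xi>) (case_nat x (\<lambda>n. Y n \<xi>)) (\<lambda>t. X t \<xi>)"
    unfolding jump_boundary_diffusion_def by blast
  from BM interpret prob_space M
    by (simp add: standard_brownian_motion_def)
  have space_S: "space ?S = {a<..<b}"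
    by (simp add: interval_space_def space_restrict_space)
  have borel_S: "f \<in> borel_measurable borel \<Longrightarrow> f \<in> borel_measurable ?S" for f :: "real \<Rightarrow> real"
    unfolding interval_space_def by (rule measurable_restrict_space1)
  have B0: "AE \<xi> in M. B 0 \<xi> = 0"
    using BM by (simp add: standard_brownian_motion_def)
  have normal: "distributed M lborel (\<lambda>\<xi>. B t \<xi> - B 0 \<xi>) (normal_density 0 (sqrt t))"
  proof -
    have "\<forall>s t. 0 \<le> s \<longrightarrow> s < t \<longrightarrow>
        distributed M lborel (\<lambda>\<xi>. B t \<xi> - B s \<xi>) (normal_density 0 (sqrt (t - s)))"
      using BM unfolding standard_brownian_motion_def by (elim conjE)
    from this[rule_format, of 0 t] \<open>0 < t\<close> show ?thesis
      by simp
  qed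
  have Ym: "AE \<xi> in M. \<forall>n. Y n \<xi> = ?m"
  proof -
    have "AE \<xi> in M. Y n \<xi> = ?m" for n
    proof -
      have m: "?m \<in> space ?S"
        using \<open>a < b\<close> by (simp add: space_S)
      have [measurable]: "(\<lambda>y. y) \<in> borel_measurable ?S"
        by (rule borel_S) simp
      have meas: "Measurable.pred ?S (\<lambda>y. y = ?m)"
        by measurable
      have "AE y in distr M ?S (Y n). y = ?m"
        unfolding Y(2) using AE_return[OF m meas] by simp
      then show ?thesis
        by (subst (asm) AE_distr_iff[OF Y(1)]) (use meas in \<open>auto simp: pred_def\<close>)
    qed
    then show ?thesis
      by (simp add: AE_all_countable)
  qed
  have "(\<integral>y. cos (\<omega> * y + \<theta>) \<partial>distr M ?S (X t)) = expectation (\<lambda>\<xi>. cos (\<omega> * X t \<xi> + \<theta>))"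
    using Xm[of t] \<open>0 < t\<close> by (subst integral_distr) (auto intro: borel_S)
  also have "\<dots> = expectation (\<lambda>\<xi>. cos ((\<omega> * x + \<omega> * \<mu> * t + \<theta>) + (\<omega> * \<sigma>) * (B t \<xi> - B 0 \<xi>)))"
  proof (rule integral_cong_AE)
    have "(\<lambda>y. y) \<in> borel_measurable ?S"
      by (rule borel_S) simp
    from measurable_compose[OF Xm this] \<open>0 < t\<close> have [measurable]: "X t \<in> borel_measurable M"
      by simp
    have [measurable]: "B t \<in> borel_measurable M" "B 0 \<in> borel_measurable M"
      using BM \<open>0 < t\<close> by (auto simp: standard_brownian_motion_def)
    show "(\<lambda>\<xi>. cos (\<omega> * X t \<xi> + \<theta>)) \<in> borel_measurable M"
      "(\<lambda>\<xi>. cos ((\<omega> * x + \<omega> * \<mu> * t + \<theta>) + (\<omega> * \<sigma>) * (B t \<xi> - B 0 \<xi>))) \<in> borel_measurable M"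
      by measurable
    show "AE \<xi> in M. cos (\<omega> * X t \<xi> + \<theta>)
        = cos ((\<omega> * x + \<omega> * \<mu> * t + \<theta>) + (\<omega> * \<sigma>) * (B t \<xi> - B 0 \<xi>))"
      using path Ym
    proof eventually_elim
      case (elim \<xi>)
      have "\<omega> * (r + (b - a) / 2) + \<theta> = (\<omega> * r + \<theta>) + 2 * pi" for r
        using \<open>a < b\<close> by (simp add: \<omega>_def field_simps)
      then have "cos (\<omega> * (r + (b - a) / 2) + \<theta>) = cos (\<omega> * r + \<theta>)" for r
        by (simp only: cos_periodic)
      from periodic_observable_of_jump_boundary_path[where g = "\<lambda>r. cos (\<omega> * r + \<theta>)", OF elim(1) _ this]
      have "cos (\<omega> * X t \<xi> + \<theta>) = cos (\<omega> * (x + \<sigma> * (B t \<xi> - B 0 \<xi>) + \<mu> * t) + \<theta>)"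
        using elim(2) \<open>0 < t\<close> by simp
      then show ?case
        by (simp add: algebra_simps)
    qed
  qed
  also have "\<dots> = exp (- (\<omega> * \<sigma> * sqrt t)\<^sup>2 / 2) * cos (\<omega> * x + \<omega> * \<mu> * t + \<theta>)"
    by (rule expectation_cos_normal[OF normal]) (use \<open>0 < t\<close> in simp)
  finally show ?thesis
    using \<open>0 < t\<close> by (simp add: power_mult_distrib)
qed

section \<open>The spectral gap is bounded uniformly in the drift\<close>

text \<open>
  A periodic observable started at the midpoint keeps an oscillation of amplitude \<open>exp (- \<kappa> t)\<close>
  that is absent in equilibrium, and the convergence in total variation cannot be faster than
  the decay of this oscillation.
\<close>

lemma spectral_gap_jump_boundary_le:
  assumes "a < b" "0 < \<sigma>" "0 < \<mu>"
    and X: "\<And>x. x \<in> {a<..<b} \<Longrightarrow>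
      jump_boundary_diffusion M a b \<sigma> \<mu> (return (interval_space a b) ((a + b) / 2)) x (X x)"
    and gap: "has_spectral_gap (interval_space a b) (\<lambda>t x. distr M (interval_space a b) (X x t)) \<gamma>"
  shows "\<gamma> \<le> (4 * pi / (b - a) * \<sigma>)\<^sup>2 / 2"
proof -
  let ?S = "interval_space a b"
  define \<omega> where "\<omega> = 4 * pi / (b - a)"
  define \<kappa> where "\<kappa> = (\<omega> * \<sigma>)\<^sup>2 / 2"
  define K where "K t x = distr M ?S (X x t)" for t x
  define m where "m = (a + b) / 2"
  have "0 < \<omega>" "0 < \<kappa>" and m: "m \<in> {a<..<b}"
    using assms(1,2) by (auto simp: \<omega>_def \<kappa>_def m_def)
  from gap obtain \<pi> where inv: "invariant_distribution ?S K \<pi>"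
    and lim: "((\<lambda>t. - (1 / t * ln (SUP x\<in>space ?S. tv_dist (K t x) \<pi>))) \<longlongrightarrow> \<gamma>) at_top"
    unfolding has_spectral_gap_def K_def by auto
  from inv have \<pi>: "prob_space \<pi>" and sets_\<pi>: "sets \<pi> = sets ?S"
    and K: "\<And>t. 0 \<le> t \<Longrightarrow> K t \<in> measurable ?S (prob_algebra ?S)"
    and bind: "\<And>t. 0 \<le> t \<Longrightarrow> \<pi> \<bind> K t = \<pi>"
    unfolding invariant_distribution_def by auto
  interpret \<pi>: prob_space \<pi> by (rule \<pi>)
  have space_S: "space ?S = {a<..<b}"
    by (simp add: interval_space_def space_restrict_space)
  have space_\<pi>: "space \<pi> = {a<..<b}"
    using sets_eq_imp_space_eq[OF sets_\<pi>] space_S by simp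
  have borel_S: "f \<in> borel_measurable borel \<Longrightarrow> f \<in> borel_measurable ?S" for f :: "real \<Rightarrow> real"
    unfolding interval_space_def by (rule measurable_restrict_space1)
  have prob_K: "prob_space (K t x)" if "0 \<le> t" "x \<in> {a<..<b}" for t x
    using measurable_space[OF K[OF that(1)], of x] that(2) by (simp add: space_prob_algebra space_S)
  have sets_K: "sets (K t x) = sets ?S" for t x
    by (simp add: K_def)
  have cos_K: "(\<integral>y. cos (\<omega> * y + \<theta>) \<partial>K t x) = exp (- \<kappa> * t) * cos (\<omega> * x + \<omega> * \<mu> * t + \<theta>)"
    if "0 < t" "x \<in> {a<..<b}" for t x \<theta>
    using expectation_cos_jump_boundary_diffusion[OF assms(1,2) that(2,1) X[OF that(2)]]
    by (simp add: K_def \<omega>_def \<kappa>_def)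
  have cos_\<pi>: "(\<integral>y. cos (\<omega> * y + \<theta>) \<partial>\<pi>) = 0" for \<theta>
  proof -
    \<comment> \<open>In this time the drift turns the phase by exactly one full turn, so that the kernel merely
      multiplies the observable by a number smaller than one.\<close>
    define t where "t = 2 * pi / (\<omega> * \<mu>)"
    have "0 < t"
      using \<open>0 < \<omega>\<close> \<open>0 < \<mu>\<close> by (simp add: t_def)
    have "(\<integral>y. cos (\<omega> * y + \<theta>) \<partial>\<pi>) = (\<integral>y. cos (\<omega> * y + \<theta>) \<partial>(\<pi> \<bind> K t))"
      using bind[of t] \<open>0 < t\<close> by simp
    also have "\<dots> = (\<integral>x. \<integral>y. cos (\<omega> * y + \<theta>) \<partial>K t x \<partial>\<pi>)"
    proof (rule integral_bind[where B = 1 and B' = 1])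
      show "K t \<in> \<pi> \<rightarrow>\<^sub>M subprob_algebra ?S"
        using measurable_prob_algebraD[OF K[of t]] \<open>0 < t\<close> measurable_cong_sets[OF sets_\<pi> refl] by auto
      show "AE x in \<pi>. emeasure (K t x) (space (K t x)) \<le> ennreal 1"
        using prob_space.emeasure_space_1[OF prob_K] \<open>0 < t\<close> by (intro AE_I2) (auto simp: space_\<pi>)
    qed (auto intro: borel_S \<pi>.finite_measure_axioms)
    also have "\<dots> = (\<integral>x. exp (- \<kappa> * t) * cos (\<omega> * x + \<theta>) \<partial>\<pi>)"
    proof (rule Bochner_Integration.integral_cong[OF refl])
      fix x assume "x \<in> space \<pi>"
      have "\<omega> * x + \<omega> * \<mu> * t + \<theta> = (\<omega> * x + \<theta>) + 2 * pi"
        using \<open>0 < \<omega>\<close> \<open>0 < \<mu>\<close> by (simp add: t_def)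
      then have "cos (\<omega> * x + \<omega> * \<mu> * t + \<theta>) = cos (\<omega> * x + \<theta>)"
        by (simp only: cos_periodic)
      then show "(\<integral>y. cos (\<omega> * y + \<theta>) \<partial>K t x) = exp (- \<kappa> * t) * cos (\<omega> * x + \<theta>)"
        using cos_K[OF \<open>0 < t\<close>] \<open>x \<in> space \<pi>\<close> by (simp add: space_\<pi>)
    qed
    finally have "(\<integral>y. cos (\<omega> * y + \<theta>) \<partial>\<pi>) = exp (- \<kappa> * t) * (\<integral>y. cos (\<omega> * y + \<theta>) \<partial>\<pi>)"
      by simp
    moreover have "exp (- \<kappa> * t) \<noteq> 1"
      using \<open>0 < \<kappa>\<close> \<open>0 < t\<close> by simp
    ultimately show ?thesis
      by auto
  qed
  have tv: "exp (- \<kappa> * t) / 2 \<le> tv_dist (K t m) \<pi>" if "0 < t" for t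
  proof -
    \<comment> \<open>This phase cancels that of the expectation at time \<open>t\<close>, which is then the full amplitude.
      The observable is rescaled to take values in \<open>[0, 1]\<close>.\<close>
    define \<theta> where "\<theta> = - (\<omega> * m + \<omega> * \<mu> * t)"
    define u where "u y = (1 + cos (\<omega> * y + \<theta>)) / 2" for y
    have bounds: "0 \<le> u y \<and> u y \<le> 1" for y
    proof -
      have "0 \<le> (1 + c) / 2 \<and> (1 + c) / 2 \<le> 1" if "- 1 \<le> c" "c \<le> 1" for c :: real
        using that by simp
      then show ?thesis
        unfolding u_def using cos_ge_minus_one cos_le_one by blast
    qed
    have cos_meas: "(\<lambda>y. cos (\<omega> * y + \<theta>)) \<in> borel_measurable ?S"
      by (rule borel_S) simp
    have integral_u: "(\<integral>y. u y \<partial>R) = (1 + (\<integral>y. cos (\<omega> * y + \<theta>) \<partial>R)) / 2"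
      if "prob_space R" "sets R = sets ?S" for R
    proof -
      interpret R: prob_space R by fact
      have "(\<lambda>y. cos (\<omega> * y + \<theta>)) \<in> borel_measurable R"
        using cos_meas measurable_cong_sets[OF that(2) refl] by blast
      then have "integrable R (\<lambda>y. cos (\<omega> * y + \<theta>))"
        by (intro R.integrable_const_bound[of _ 1]) auto
      then show ?thesis
        unfolding u_def by (simp add: R.prob_space)
    qed
    have "u \<in> borel_measurable (K t m)"
      unfolding u_def K_def by (simp add: borel_S)
    from abs_integral_diff_le_tv_dist[OF prob_K \<pi> _ this bounds, of] that m sets_K sets_\<pi>
    have "\<bar>(\<integral>y. u y \<partial>K t m) - (\<integral>y. u y \<partial>\<pi>)\<bar> \<le> tv_dist (K t m) \<pi>"
      by simp
    moreover have "(\<integral>y. u y \<partial>K t m) = (1 + exp (- \<kappa> * t)) / 2"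
      using integral_u[OF prob_K sets_K] cos_K[OF that m, of \<theta>] that m by (simp add: \<theta>_def)
    moreover have "(\<integral>y. u y \<partial>\<pi>) = 1 / 2"
      using integral_u[OF \<pi> sets_\<pi>] cos_\<pi>[of \<theta>] by simp
    ultimately show ?thesis
      by (simp add: add_divide_distrib)
  qed
  have "\<forall>\<^sub>F t in at_top. - (1 / t * ln (SUP x\<in>space ?S. tv_dist (K t x) \<pi>)) \<le> \<kappa> + ln 2 / t"
    using eventually_gt_at_top[of 0]
  proof eventually_elim
    case (elim t)
    have "tv_dist (K t m) \<pi> \<le> (SUP x\<in>space ?S. tv_dist (K t x) \<pi>)"
    proof (rule cSUP_upper)
      show "bdd_above ((\<lambda>x. tv_dist (K t x) \<pi>) ` space ?S)"
        using tv_dist_le_1[OF prob_K \<pi>] elim by (auto simp: bdd_above_def space_S intro!: exI[of _ 1])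
    qed (use m space_S in simp)
    with tv[OF elim] have "exp (- \<kappa> * t) / 2 \<le> (SUP x\<in>space ?S. tv_dist (K t x) \<pi>)"
      by linarith
    then have "ln (exp (- \<kappa> * t) / 2) \<le> ln (SUP x\<in>space ?S. tv_dist (K t x) \<pi>)"
      by (intro ln_mono) auto
    then have "- \<kappa> * t - ln 2 \<le> ln (SUP x\<in>space ?S. tv_dist (K t x) \<pi>)"
      by (simp add: ln_div)
    then show ?case
      using elim by (simp add: field_simps)
  qed
  moreover have "((\<lambda>t. \<kappa> + ln 2 / t) \<longlongrightarrow> \<kappa> + 0) at_top"
    by (intro tendsto_intros tendsto_divide_0[OF tendsto_const]
        filterlim_at_top_imp_at_infinity filterlim_ident)
  ultimately have "\<gamma> \<le> \<kappa> + 0"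
    using lim by (intro tendsto_le[of at_top]) auto
  then show ?thesis
    by (simp add: \<kappa>_def \<omega>_def)
qed

section \<open>Small positive real numbers are not eigenvalues\<close>

lemma first_order_linear_ode_solution:
  fixes u :: "real \<Rightarrow> complex"
  assumes "convex S"
    and "\<And>x. x \<in> S \<Longrightarrow> (u has_vector_derivative of_real r * u x) (at x within S)"
  obtains c where "\<And>x. x \<in> S \<Longrightarrow> u x = c * of_real (exp (r * x))"
proof -
  have "((\<lambda>x. u x * of_real (exp (- r * x))) has_vector_derivative 0) (at x within S)" if "x \<in> S" for x
  proof -
    have "((\<lambda>x. exp (- r * x)) has_real_derivative - r * exp (- r * x)) (at x within S)"
      by (auto intro!: derivative_eq_intros)
    then have "((\<lambda>x. complex_of_real (exp (- r * x))) has_vector_derivative of_real (- r * exp (- r * x)))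
        (at x within S)"
      by (intro has_vector_derivative_of_real)
        (simp add: has_real_derivative_iff_has_vector_derivative)
    from has_vector_derivative_mult[OF assms(2)[OF that] this] show ?thesis
      by (simp add: algebra_simps)
  qed
  then obtain c where c: "\<And>x. x \<in> S \<Longrightarrow> u x * of_real (exp (- r * x)) = c"
    using has_vector_derivative_zero_constant[OF assms(1)] by blast
  have "u x = c * of_real (exp (r * x))" if "x \<in> S" for x
  proof -
    have "c * of_real (exp (r * x)) = u x * of_real (exp (- r * x) * exp (r * x))"
      using c[OF that] by (simp add: mult.assoc)
    then show ?thesis
      by (simp add: exp_add[symmetric])
  qed
  then show ?thesis
    by (rule that)
qed

text \<open>
  The smallness of \<open>\<gamma>\<close> makes the exponents \<open>p\<close> and \<open>q\<close> of the second-order equation real, distinct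
  and negative. On a shift by half the length of the interval, \<open>exp (p x)\<close> and \<open>exp (q x)\<close> are
  multiplied by factors \<open>E p\<close> and \<open>E q\<close>, different from each other and from one. The two boundary
  conditions state that two consecutive increments of \<open>f\<close> vanish; as the exponential
  contributions to these increments are multiplied by different factors from the first to the
  second, each of them vanishes.
\<close>

lemma small_positive_real_not_eigenvalue:
  fixes \<gamma> :: real
  assumes "a < b" "0 < \<sigma>" "0 < \<mu>" "0 < \<gamma>" and small: "2 * \<gamma> * \<sigma>\<^sup>2 < \<mu>\<^sup>2"
  shows "\<not> is_eigenvalue {a..b} (\<lambda>f x. - generator a b \<sigma> \<mu> f x)
    (generator_domain a b ((a + b) / 2)) (of_real \<gamma>)"
proof
  define m where "m = (a + b) / 2"
  define h where "h = (b - a) / 2"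
  assume "is_eigenvalue {a..b} (\<lambda>f x. - generator a b \<sigma> \<mu> f x)
    (generator_domain a b ((a + b) / 2)) (of_real \<gamma>)"
  then obtain f where f: "f \<in> C2_interval a b" and boundary: "f a = f b" "f b = f m"
    and nonzero: "\<exists>x\<in>{a..b}. f x \<noteq> 0"
    and eigen: "\<And>x. x \<in> {a..b} \<Longrightarrow> - generator a b \<sigma> \<mu> f x = of_real \<gamma> * f x"
    unfolding is_eigenvalue_def generator_domain_def m_def mem_Collect_eq by blast
  define f' where "f' = interval_deriv a b f"
  define f'' where "f'' = interval_deriv a b f'"
  have f_deriv: "(f has_vector_derivative f' x) (at x within {a..b})" if "x \<in> {a..b}" for x
    using f that unfolding C2_interval_def f'_def interval_deriv_def
    by (auto simp: differentiable_on_def vector_derivative_works)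
  have f'_deriv: "(f' has_vector_derivative f'' x) (at x within {a..b})" if "x \<in> {a..b}" for x
  proof -
    have "f' differentiable_on {a..b}"
      using f by (simp add: C2_interval_def f'_def)
    then show ?thesis
      using that unfolding f''_def interval_deriv_def
      by (auto simp: differentiable_on_def vector_derivative_works)
  qed
  define d where "d = sqrt (\<mu>\<^sup>2 - 2 * \<gamma> * \<sigma>\<^sup>2)"
  define p where "p = (- \<mu> + d) / \<sigma>\<^sup>2"
  define q where "q = (- \<mu> - d) / \<sigma>\<^sup>2"
  have d: "0 < d" "d\<^sup>2 = \<mu>\<^sup>2 - 2 * \<gamma> * \<sigma>\<^sup>2"
    using small by (auto simp: d_def)
  have "d\<^sup>2 < \<mu>\<^sup>2"
    using d(2) \<open>0 < \<gamma>\<close> \<open>0 < \<sigma>\<close> by simp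
  then have "d < \<mu>"
    using \<open>0 < \<mu>\<close> by (intro power_less_imp_less_base[of d 2 \<mu>]) auto
  then have roots: "q < p" "p < 0"
    using d(1) \<open>0 < \<sigma>\<close> by (auto simp: p_def q_def divide_simps)
  have vieta: "\<sigma>\<^sup>2 * (p + q) = - 2 * \<mu>" "\<sigma>\<^sup>2 * (p * q) = 2 * \<gamma>"
  proof -
    show "\<sigma>\<^sup>2 * (p + q) = - 2 * \<mu>"
      using \<open>0 < \<sigma>\<close> by (simp add: p_def q_def field_simps)
    have "\<sigma>\<^sup>2 * (p * q) * \<sigma>\<^sup>2 = \<mu>\<^sup>2 - d\<^sup>2"
      using \<open>0 < \<sigma>\<close> by (simp add: p_def q_def power2_eq_square field_simps)
    also have "\<dots> = 2 * \<gamma> * \<sigma>\<^sup>2"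
      using d(2) by simp
    finally show "\<sigma>\<^sup>2 * (p * q) = 2 * \<gamma>"
      using \<open>0 < \<sigma>\<close> by simp
  qed
  have ode: "f'' x = of_real (p + q) * f' x - of_real (p * q) * f x" if "x \<in> {a..b}" for x
  proof -
    have "of_real (\<sigma>\<^sup>2) * f'' x = of_real (- 2 * \<mu>) * f' x - of_real (2 * \<gamma>) * f x"
      using eigen[OF that] unfolding generator_def f'_def[symmetric] f''_def[symmetric]
      by (simp add: field_simps)
    also have "\<dots> = of_real (\<sigma>\<^sup>2) * (of_real (p + q) * f' x - of_real (p * q) * f x)"
      unfolding vieta[symmetric] by (simp add: algebra_simps)
    finally show ?thesis
      using \<open>0 < \<sigma>\<close> by simp
  qed
  \<comment> \<open>The operator factors into two commuting first-order ones; applying either of them to \<open>f\<close>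
    leaves a pure exponential, and the difference of the two results is a multiple of \<open>f\<close>.\<close>
  have factor: "((\<lambda>x. f' x - of_real r * f x) has_vector_derivative
      of_real s * (f' x - of_real r * f x)) (at x within {a..b})"
    if "x \<in> {a..b}" "p + q = r + s" "p * q = r * s" for r s x
  proof (rule has_vector_derivative_eq_rhs)
    show "((\<lambda>x. f' x - of_real r * f x) has_vector_derivative f'' x - of_real r * f' x)
        (at x within {a..b})"
      by (intro has_vector_derivative_diff has_vector_derivative_mult_right f_deriv f'_deriv that(1))
    show "f'' x - of_real r * f' x = of_real s * (f' x - of_real r * f x)"
      unfolding ode[OF that(1)] that(2,3) by (simp add: algebra_simps)
  qed
  obtain A where A: "\<And>x. x \<in> {a..b} \<Longrightarrow> f' x - of_real q * f x = A * of_real (exp (p * x))"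
    using first_order_linear_ode_solution[OF _ factor[of _ q p]] by auto
  obtain C where C: "\<And>x. x \<in> {a..b} \<Longrightarrow> f' x - of_real p * f x = C * of_real (exp (q * x))"
    using first_order_linear_ode_solution[OF _ factor[of _ p q]] by auto
  have f_eq: "of_real (p - q) * f x = A * of_real (exp (p * x)) - C * of_real (exp (q * x))"
    if "x \<in> {a..b}" for x
    unfolding A[OF that, symmetric] C[OF that, symmetric] by (simp add: algebra_simps)
  define E where "E r = (of_real (exp (r * h)) :: complex)" for r
  \<comment> \<open>The contributions of the two exponentials to the increment of \<open>(p - q) f\<close> from \<open>a\<close> to the
    midpoint; \<open>C'\<close> enters with a minus sign.\<close>
  define A' where "A' = A * of_real (exp (p * a)) * (E p - 1)"
  define C' where "C' = C * of_real (exp (q * a)) * (E q - 1)"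
  have "0 < h" and in_ab: "a \<in> {a..b}" "m \<in> {a..b}" "b \<in> {a..b}"
    using \<open>a < b\<close> by (auto simp: h_def m_def)
  have shift: "of_real (exp (r * m)) = of_real (exp (r * a)) * E r"
    "of_real (exp (r * b)) = of_real (exp (r * a)) * E r * E r" for r
    unfolding E_def of_real_mult[symmetric] exp_add[symmetric] h_def m_def
    by (simp_all add: field_simps)
  have "of_real (p - q) * f m - of_real (p - q) * f a = 0"
    using boundary by simp
  then have 1: "A' = C'"
    unfolding f_eq[OF in_ab(1)] f_eq[OF in_ab(2)] shift A'_def C'_def by (simp add: algebra_simps)
  have "of_real (p - q) * f b - of_real (p - q) * f m = 0"
    using boundary by simp
  then have 2: "A' * E p = C' * E q"
    unfolding f_eq[OF in_ab(2)] f_eq[OF in_ab(3)] shift A'_def C'_def by (simp add: algebra_simps)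
  have "E p \<noteq> E q"
    using roots(1) \<open>0 < h\<close> by (simp add: E_def)
  with 1 2 have "A' = 0" "C' = 0"
    by auto
  moreover have "E p \<noteq> 1" "E q \<noteq> 1"
    using roots \<open>0 < h\<close> by (auto simp: E_def)
  ultimately have "A = 0" "C = 0"
    by (auto simp: A'_def C'_def)
  then have "f x = 0" if "x \<in> {a..b}" for x
    using f_eq[OF that] roots(1) by simp
  with nonzero show False
    by blast
qed

section \<open>Eigenvalues at the spectral gap for large drift\<close>

theorem corollary3:
  fixes a b \<sigma> x\<^sub>0 :: real
  assumes "a < b" and "0 < \<sigma>" and "x\<^sub>0 = (a + b) / 2"
  shows "\<exists>\<mu>\<^sub>0. \<forall>\<mu>\<ge>\<mu>\<^sub>0. \<forall>(M :: 'w measure) X \<gamma>\<^sub>1.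
    (\<forall>x\<in>{a<..<b}. jump_boundary_diffusion M a b \<sigma> \<mu> (return (interval_space a b) x\<^sub>0) x (X x)) \<longrightarrow>
    has_spectral_gap (interval_space a b) (\<lambda>t x. distr M (interval_space a b) (X x t)) \<gamma>\<^sub>1 \<longrightarrow>
    {z. Re z = \<gamma>\<^sub>1 \<and>
        is_eigenvalue {a..b} (\<lambda>f x. - generator a b \<sigma> \<mu> f x) (generator_domain a b x\<^sub>0) z}
      \<subseteq> UNIV - \<real>"
  \<comment> \<open>Any \<open>\<mu>\<close> above \<open>\<omega> \<sigma>\<^sup>2\<close> pushes the real eigenvalues beyond \<open>(\<omega> \<sigma>)\<^sup>2 / 2\<close>; the added one makes
    the inequality strict.\<close>
proof (intro exI[of _ "4 * pi / (b - a) * \<sigma>\<^sup>2 + 1"] allI impI subsetI DiffI UNIV_I notI)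
  fix \<mu> :: real and M :: "'w measure" and X \<gamma>\<^sub>1 z
  assume \<mu>: "4 * pi / (b - a) * \<sigma>\<^sup>2 + 1 \<le> \<mu>"
    and X: "\<forall>x\<in>{a<..<b}. jump_boundary_diffusion M a b \<sigma> \<mu> (return (interval_space a b) x\<^sub>0) x (X x)"
    and gap: "has_spectral_gap (interval_space a b) (\<lambda>t x. distr M (interval_space a b) (X x t)) \<gamma>\<^sub>1"
    and z: "z \<in> {z. Re z = \<gamma>\<^sub>1 \<and>
        is_eigenvalue {a..b} (\<lambda>f x. - generator a b \<sigma> \<mu> f x) (generator_domain a b x\<^sub>0) z}"
    and "z \<in> \<real>"
  define \<omega> where "\<omega> = 4 * pi / (b - a)"
  have "0 < \<omega>"
    using assms(1) by (simp add: \<omega>_def)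
  then have "0 \<le> \<omega> * \<sigma>\<^sup>2"
    by simp
  with \<mu> have "0 < \<mu>" "\<omega> * \<sigma>\<^sup>2 < \<mu>"
    unfolding \<omega>_def[symmetric] by linarith+
  have "0 < \<gamma>\<^sub>1"
    using gap by (simp add: has_spectral_gap_def)
  have "\<gamma>\<^sub>1 \<le> (\<omega> * \<sigma>)\<^sup>2 / 2"
    using spectral_gap_jump_boundary_le[OF assms(1,2) \<open>0 < \<mu>\<close> _ gap] X assms(3) by (simp add: \<omega>_def)
  then have "2 * \<gamma>\<^sub>1 * \<sigma>\<^sup>2 \<le> (\<omega> * \<sigma>)\<^sup>2 * \<sigma>\<^sup>2"
    by (intro mult_right_mono) auto
  also have "\<dots> = (\<omega> * \<sigma>\<^sup>2)\<^sup>2"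
    by (simp add: power_mult_distrib power2_eq_square)
  also have "\<dots> < \<mu>\<^sup>2"
    using \<open>0 \<le> \<omega> * \<sigma>\<^sup>2\<close> \<open>\<omega> * \<sigma>\<^sup>2 < \<mu>\<close> by (intro power_strict_mono) auto
  finally have "2 * \<gamma>\<^sub>1 * \<sigma>\<^sup>2 < \<mu>\<^sup>2" .
  from small_positive_real_not_eigenvalue[OF assms(1,2) \<open>0 < \<mu>\<close> \<open>0 < \<gamma>\<^sub>1\<close> this]
  show False
    using z \<open>z \<in> \<real>\<close> assms(3) by (auto elim!: Reals_cases)
qed

end
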